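(* Let $R$ be an integral domain that is not a field. The spaces $\widetilde{M(R)}$ and $M(R)$ are ultraconnected. Therefore they are normal, limit point compact, pseudocompact and path-connected.
   Context: For $X\subset R$, $X^0=X\setminus\{0\}$; $\langle r\rangle$ is the ideal of $R$ generated by $r$. For $r\in R$ let $\sigma_r=\{s\in R:\langle r\rangle+\langle s\rangle=R\}$. $\widetilde{M(R)}$ is the set $R$ with the topology having the basis $\{\sigma_r: r\in R\}$. The Macías space $M(R)$ is the set $R^0$ with the topology having the basis $\{\sigma_k^0: k\in R^0\}$. A space is ultraconnected if any two nonempty closed sets have nonempty intersection; normal if any two disjoint closed sets have disjoint open neighbourhoods (no $\mathrm{T}_1$ assumption); limit point compact if every infinite subset has a limit point; pseudocompact if every continuous real-valued function on it is bounded. *)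

theory Defs
  imports "HOL-Algebra.Ideal" "HOL-Analysis.Analysis"
begin

definition macias_sigma :: "('a, 'm) ring_scheme \<Rightarrow> 'a \<Rightarrow> 'a set" where
  "macias_sigma R r =
     {s \<in> carrier R. genideal R {r} <+>\<^bsub>R\<^esub> genideal R {s} = carrier R}"

text \<open>
  The constant \<^term>\<open>topology\<close> is only meaningful on families of sets that satisfy
  \<^const>\<open>istopology\<close>; for the two definitions below this is established over an integral
  domain by the lemmas \<open>openin_Macias_tilde\<close> and \<open>openin_Macias\<close>, and the carriers of
  the spaces by \<open>topspace_Macias_tilde\<close> and \<open>topspace_Macias\<close>.
\<close>

definition Macias_tilde :: "('a, 'm) ring_scheme \<Rightarrow> 'a topology" where
  "Macias_tilde R =
     topology (arbitrary union_of (\<lambda>B. \<exists>r \<in> carrier R. B = macias_sigma R r))"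

definition Macias :: "('a, 'm) ring_scheme \<Rightarrow> 'a topology" where
  "Macias R =
     topology (arbitrary union_of
       (\<lambda>B. \<exists>k \<in> carrier R - {\<zero>\<^bsub>R\<^esub>}. B = macias_sigma R k - {\<zero>\<^bsub>R\<^esub>}))"

definition ultraconnected_space :: "'a topology \<Rightarrow> bool" where
  "ultraconnected_space X \<longleftrightarrow>
     (\<forall>C D. closedin X C \<and> closedin X D \<and> C \<noteq> {} \<and> D \<noteq> {} \<longrightarrow> C \<inter> D \<noteq> {})"

definition limit_point_compact_space :: "'a topology \<Rightarrow> bool" where
  "limit_point_compact_space X \<longleftrightarrow>
     (\<forall>S. S \<subseteq> topspace X \<and> infinite S \<longrightarrow> X derived_set_of S \<noteq> {})"

definition pseudocompact_space :: "'a topology \<Rightarrow> bool" where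
  "pseudocompact_space X \<longleftrightarrow>
     (\<forall>f. continuous_map X euclideanreal f \<longrightarrow> bounded (f ` topspace X))"

lemma (in cring) macias_sigma_iff:
  assumes "r \<in> carrier R"
  shows "s \<in> macias_sigma R r \<longleftrightarrow>
    s \<in> carrier R \<and> (\<exists>a\<in>carrier R. \<exists>b\<in>carrier R. a \<otimes> r \<oplus> b \<otimes> s = \<one>)"
proof (cases "s \<in> carrier R")
  case s: True
  let ?I = "PIdl r <+>\<^bsub>R\<^esub> PIdl s"
  have eq: "genideal R {r} <+>\<^bsub>R\<^esub> genideal R {s} = ?I"
    using assms s by (simp add: cgenideal_eq_genideal)
  have "ideal ?I R"
    using assms s by (simp add: add_ideals cgenideal_ideal)
  then have "?I = carrier R \<longleftrightarrow> \<one> \<in> ?I"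
    using ideal.one_imp_carrier by blast
  also have "\<dots> \<longleftrightarrow> (\<exists>a\<in>carrier R. \<exists>b\<in>carrier R. a \<otimes> r \<oplus> b \<otimes> s = \<one>)"
    by (simp only: set_add_def' cgenideal_def) (simp, metis)
  finally show ?thesis
    using s eq by (simp add: macias_sigma_def)
qed (simp add: macias_sigma_def)

lemma (in cring) macias_sigma_one: "macias_sigma R \<one> = carrier R"
proof -
  have "s \<in> macias_sigma R \<one>" if "s \<in> carrier R" for s
  proof -
    have "\<one> \<otimes> \<one> \<oplus> \<zero> \<otimes> s = \<one>"
      using that by simp
    then show ?thesis
      using that macias_sigma_iff[OF one_closed] by blast
  qed
  then show ?thesis
    by (auto simp: macias_sigma_def)
qed

lemma (in cring) macias_sigma_Int:
  assumes r: "r \<in> carrier R" and s: "s \<in> carrier R"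
  shows "macias_sigma R r \<inter> macias_sigma R s = macias_sigma R (r \<otimes> s)"
proof (intro Set.set_eqI iffI)
  fix x assume "x \<in> macias_sigma R r \<inter> macias_sigma R s"
  then obtain a b c d where x: "x \<in> carrier R"
    and c: "a \<in> carrier R" "b \<in> carrier R" "c \<in> carrier R" "d \<in> carrier R"
    and 1: "a \<otimes> r \<oplus> b \<otimes> x = \<one>" "c \<otimes> s \<oplus> d \<otimes> x = \<one>"
    using r s by (auto simp: macias_sigma_iff)
  have "(a \<otimes> c) \<otimes> (r \<otimes> s) \<oplus> (a \<otimes> r \<otimes> d \<oplus> b \<otimes> (c \<otimes> s \<oplus> d \<otimes> x)) \<otimes> x
        = (a \<otimes> r \<oplus> b \<otimes> x) \<otimes> (c \<otimes> s \<oplus> d \<otimes> x)"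
    using r s c x by algebra
  also have "\<dots> = \<one>" using 1 by simp
  finally show "x \<in> macias_sigma R (r \<otimes> s)"
    using r s c x by (subst macias_sigma_iff) (auto intro!: bexI)
next
  fix x assume "x \<in> macias_sigma R (r \<otimes> s)"
  then obtain a b where x: "x \<in> carrier R" and c: "a \<in> carrier R" "b \<in> carrier R"
    and 1: "a \<otimes> (r \<otimes> s) \<oplus> b \<otimes> x = \<one>"
    using r s by (auto simp: macias_sigma_iff)
  have "(a \<otimes> s) \<otimes> r \<oplus> b \<otimes> x = \<one>" "(a \<otimes> r) \<otimes> s \<oplus> b \<otimes> x = \<one>"
    using 1 r s c x by (simp_all add: m_ac)
  then show "x \<in> macias_sigma R r \<inter> macias_sigma R s"
    using r s c x by (auto simp: macias_sigma_iff)
qed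

lemma (in cring) openin_Macias_tilde:
  "openin (Macias_tilde R) = arbitrary union_of (\<lambda>B. \<exists>r \<in> carrier R. B = macias_sigma R r)"
  unfolding Macias_tilde_def
proof (rule topology_inverse', rule istopology_base)
  fix S T
  assume "\<exists>r\<in>carrier R. S = macias_sigma R r" "\<exists>r\<in>carrier R. T = macias_sigma R r"
  then show "\<exists>r\<in>carrier R. S \<inter> T = macias_sigma R r"
    using macias_sigma_Int m_closed by metis
qed

lemma (in domain) openin_Macias:
  "openin (Macias R) = arbitrary union_of
     (\<lambda>B. \<exists>k \<in> carrier R - {\<zero>}. B = macias_sigma R k - {\<zero>})"
  unfolding Macias_def
proof (rule topology_inverse', rule istopology_base)
  fix S T
  assume "\<exists>k\<in>carrier R - {\<zero>}. S = macias_sigma R k - {\<zero>}"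
    and "\<exists>k\<in>carrier R - {\<zero>}. T = macias_sigma R k - {\<zero>}"
  then obtain k l where k: "k \<in> carrier R - {\<zero>}" "S = macias_sigma R k - {\<zero>}"
    and l: "l \<in> carrier R - {\<zero>}" "T = macias_sigma R l - {\<zero>}" by blast
  have "k \<otimes> l \<in> carrier R - {\<zero>}"
    using k l integral by auto
  moreover have "S \<inter> T = macias_sigma R (k \<otimes> l) - {\<zero>}"
    using k l macias_sigma_Int[of k l] by auto
  ultimately show "\<exists>k\<in>carrier R - {\<zero>}. S \<inter> T = macias_sigma R k - {\<zero>}"
    by blast
qed

lemma (in cring) topspace_Macias_tilde: "topspace (Macias_tilde R) = carrier R"
proof
  show "topspace (Macias_tilde R) \<subseteq> carrier R"
    using openin_topspace[of "Macias_tilde R"]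
    unfolding openin_Macias_tilde arbitrary_union_of_alt macias_sigma_def by blast
  have "openin (Macias_tilde R) (carrier R)"
    unfolding openin_Macias_tilde arbitrary_union_of_alt
    using macias_sigma_one one_closed by blast
  then show "carrier R \<subseteq> topspace (Macias_tilde R)"
    by (rule openin_subset)
qed

lemma (in domain) topspace_Macias: "topspace (Macias R) = carrier R - {\<zero>}"
proof
  show "topspace (Macias R) \<subseteq> carrier R - {\<zero>}"
    using openin_topspace[of "Macias R"]
    unfolding openin_Macias arbitrary_union_of_alt macias_sigma_def by blast
  have "\<one> \<in> carrier R - {\<zero>}" by simp
  then have "openin (Macias R) (carrier R - {\<zero>})"
    unfolding openin_Macias arbitrary_union_of_alt
    using macias_sigma_one by blast
  then show "carrier R - {\<zero>} \<subseteq> topspace (Macias R)"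
    by (rule openin_subset)
qed

end

theory Submission
  imports Defs
begin

text \<open>
  If \<open>a \<otimes> r \<oplus> b \<otimes> (x \<otimes> y) = \<one>\<close>, then \<open>a \<otimes> r \<oplus> (b \<otimes> y) \<otimes> x = \<one>\<close>: an element coprime
  to \<open>r\<close> has only divisors coprime to \<open>r\<close>. So the open sets of both spaces contain every divisor
  of each of their elements; dually, a closed set contains every multiple, within the space, of
  each of its elements. Two nonempty closed sets, with elements \<open>x\<close> and \<open>y\<close>, then share
  \<open>x \<otimes> y\<close>, which is nonzero for nonzero \<open>x\<close> and \<open>y\<close> because \<open>R\<close> has no zero divisors. This is
  ultraconnectedness.

  The other four properties hold in every ultraconnected space. Normality is immediate: of
  two disjoint closed sets one is empty, so \<open>{}\<close> and the whole space separate them. For the rest,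
  apply ultraconnectedness to the closures of two points \<open>x\<close> and \<open>y\<close>, to obtain a point \<open>z\<close> all of whose neighbourhoods contain both \<open>x\<close> and \<open>y\<close>.
  Such a \<open>z\<close> is a limit point of any set containing \<open>x \<noteq> y\<close>; a real-valued continuous function
  takes the same value at \<open>x\<close>, \<open>z\<close> and \<open>y\<close>, so it is constant; and a path may rest at \<open>x\<close>, pass
  through \<open>z\<close> for a single instant and then rest at \<open>y\<close>.
\<close>

text \<open>
  The form in which ultraconnectedness is used below: \<open>z\<close> is a common point of the closures of
  \<open>{x}\<close> and \<open>{y}\<close>.
\<close>

lemma ultraconnected_space_common_specialization:
  assumes "ultraconnected_space X" "x \<in> topspace X" "y \<in> topspace X"
  obtains z where "z \<in> topspace X" "\<And>U. openin X U \<Longrightarrow> z \<in> U \<Longrightarrow> x \<in> U \<and> y \<in> U"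
proof -
  have "X closure_of {x} \<noteq> {}" "X closure_of {y} \<noteq> {}"
    using assms(2,3) by (auto simp: closure_of_eq_empty_gen)
  then obtain z where "z \<in> X closure_of {x}" "z \<in> X closure_of {y}"
    using assms(1) closedin_closure_of[of X "{x}"] closedin_closure_of[of X "{y}"]
    unfolding ultraconnected_space_def by blast
  then show thesis
    using that unfolding in_closure_of by blast
qed

lemma ultraconnected_imp_normal_space:
  assumes "ultraconnected_space X"
  shows "normal_space X"
  unfolding normal_space_def
proof (intro allI impI, elim conjE)
  fix S T assume ST: "closedin X S" "closedin X T" "disjnt S T"
  then have "S = {} \<or> T = {}"
    using assms unfolding ultraconnected_space_def disjnt_def by blast
  then show "\<exists>U V. openin X U \<and> openin X V \<and> S \<subseteq> U \<and> T \<subseteq> V \<and> disjnt U V"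
  proof
    assume "S = {}"
    then show ?thesis
      using closedin_subset[OF ST(2)]
      by (intro exI[of _ "{}"] exI[of _ "topspace X"]) auto
  next
    assume "T = {}"
    then show ?thesis
      using closedin_subset[OF ST(1)]
      by (intro exI[of _ "topspace X"] exI[of _ "{}"]) auto
  qed
qed

text \<open>
  Two distinct points of the set suffice: their common specialization \<open>z\<close> differs from at least
  one of them.
\<close>

lemma ultraconnected_imp_limit_point_compact_space:
  assumes "ultraconnected_space X"
  shows "limit_point_compact_space X"
  unfolding limit_point_compact_space_def
proof (intro allI impI, elim conjE)
  fix S assume S: "S \<subseteq> topspace X" "infinite S"
  obtain x where x: "x \<in> S"
    using S(2) infinite_imp_nonempty by blast
  have "S - {x} \<noteq> {}"
    using S(2) by (intro infinite_imp_nonempty infinite_remove)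
  then obtain y where y: "y \<in> S" "y \<noteq> x"
    by blast
  obtain z where z: "z \<in> topspace X" "\<And>U. openin X U \<Longrightarrow> z \<in> U \<Longrightarrow> x \<in> U \<and> y \<in> U"
    using ultraconnected_space_common_specialization[OF assms] S(1) x y(1) by blast
  have "z \<in> X derived_set_of S"
    unfolding in_derived_set_of
  proof (intro conjI allI impI)
    fix U assume "z \<in> U \<and> openin X U"
    then have "x \<in> U" "y \<in> U"
      using z(2) by blast+
    then show "\<exists>w. w \<noteq> z \<and> w \<in> S \<and> w \<in> U"
      using x y by (cases "x = z") blast+
  qed (rule z(1))
  then show "X derived_set_of S \<noteq> {}"
    by blast
qed

lemma ultraconnected_imp_constant_real_map:
  fixes f :: "'a \<Rightarrow> real"
  assumes "ultraconnected_space X" and f: "continuous_map X euclideanreal f"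
    and "x \<in> topspace X" "y \<in> topspace X"
  shows "f x = f y"
proof -
  obtain z where z: "z \<in> topspace X" "\<And>U. openin X U \<Longrightarrow> z \<in> U \<Longrightarrow> x \<in> U \<and> y \<in> U"
    using ultraconnected_space_common_specialization[OF assms(1,3,4)] by blast
  have "f w = f z" if w: "w = x \<or> w = y" for w
  proof (rule ccontr)
    assume "f w \<noteq> f z"
    \<comment> \<open>The complement of \<open>f w\<close> pulls back to a neighbourhood of \<open>z\<close> that misses \<open>w\<close>.\<close>
    moreover have "openin X {v \<in> topspace X. f v \<in> - {f w}}"
      using f by (intro openin_continuous_map_preimage) auto
    ultimately show False
      using z(1) z(2)[of "{v \<in> topspace X. f v \<in> - {f w}}"] w by auto
  qed
  from this[of x] this[of y] show ?thesis
    by simp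
qed

lemma ultraconnected_imp_pseudocompact_space:
  assumes "ultraconnected_space X"
  shows "pseudocompact_space X"
  unfolding pseudocompact_space_def
proof (intro allI impI)
  fix f :: "'a \<Rightarrow> real" assume f: "continuous_map X euclideanreal f"
  show "bounded (f ` topspace X)"
  proof (cases "topspace X = {}")
    case False
    then obtain x where x: "x \<in> topspace X"
      by blast
    have "f y \<in> {f x}" if "y \<in> topspace X" for y
      using ultraconnected_imp_constant_real_map[OF assms f that x] by simp
    then have "f ` topspace X \<subseteq> {f x}"
      by (rule image_subsetI)
    then show ?thesis
      by (rule bounded_subset[rotated]) simp
  qed simp
qed

lemma ultraconnected_imp_path_connected_space:
  assumes "ultraconnected_space X"
  shows "path_connected_space X"
  unfolding path_connected_space_def
proof (intro ballI)
  fix x y assume xy: "x \<in> topspace X" "y \<in> topspace X"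
  obtain z where z: "z \<in> topspace X" "\<And>U. openin X U \<Longrightarrow> z \<in> U \<Longrightarrow> x \<in> U \<and> y \<in> U"
    using ultraconnected_space_common_specialization[OF assms xy] by blast
  define g where "g t = (if t < 1/2 then x else if t = 1/2 then z else y)" for t :: real
  have "openin (top_of_set {0..1}) {t \<in> {0..1}. g t \<in> U}" if U: "openin X U" for U
  proof -
    \<comment> \<open>The preimage of \<open>U\<close> contains \<open>1/2\<close> only if it is all of \<open>{0..1}\<close>;
      otherwise it is the union of none, one or both of the relatively open half-intervals.\<close>
    have "\<exists>T. open T \<and> {t \<in> {0..1}. g t \<in> U} = {0..1} \<inter> T"
    proof (cases "z \<in> U")
      case True
      then have "{t \<in> {0..1}. g t \<in> U} = {0..1} \<inter> UNIV"
        using z(2)[OF U] by (auto simp: g_def)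
      then show ?thesis
        by blast
    next
      case False
      let ?T = "(if x \<in> U then {..<1/2} else {}) \<union> (if y \<in> U then {1/2<..} else {}) :: real set"
      have "{t \<in> {0..1}. g t \<in> U} = {0..1} \<inter> ?T"
        using False by (auto simp: g_def split: if_splits)
      moreover have "open ?T"
        by auto
      ultimately show ?thesis
        by blast
    qed
    then show ?thesis
      unfolding openin_open by blast
  qed
  moreover have "g t \<in> topspace X" for t
    using xy z(1) by (simp add: g_def)
  ultimately have "pathin X g"
    unfolding pathin_def continuous_map_def by auto
  then show "\<exists>g. pathin X g \<and> g 0 = x \<and> g 1 = y"
    by (intro exI[of _ g]) (simp add: g_def)
qed

lemma (in cring) macias_sigma_divisor_closed:
  assumes "r \<in> carrier R" and x: "x \<in> carrier R" and y: "y \<in> carrier R"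
    and "x \<otimes> y \<in> macias_sigma R r"
  shows "x \<in> macias_sigma R r"
proof -
  obtain a b where ab: "a \<in> carrier R" "b \<in> carrier R" "a \<otimes> r \<oplus> b \<otimes> (x \<otimes> y) = \<one>"
    using assms by (auto simp: macias_sigma_iff)
  have "a \<otimes> r \<oplus> (b \<otimes> y) \<otimes> x = \<one>"
    using ab x y by (simp add: m_ac)
  then show ?thesis
    using assms ab by (auto simp: macias_sigma_iff)
qed

lemma (in cring) openin_Macias_tilde_divisor_closed:
  assumes "openin (Macias_tilde R) U" "x \<in> carrier R" "y \<in> carrier R" "x \<otimes> y \<in> U"
  shows "x \<in> U"
proof -
  obtain r where "r \<in> carrier R" "x \<otimes> y \<in> macias_sigma R r" "macias_sigma R r \<subseteq> U"
    using assms(1,4) unfolding openin_Macias_tilde arbitrary_union_of_alt by blast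
  then show ?thesis
    using macias_sigma_divisor_closed[of r x y] assms(2,3) by blast
qed

lemma (in domain) openin_Macias_divisor_closed:
  assumes "openin (Macias R) U" "x \<in> carrier R - {\<zero>}" "y \<in> carrier R" "x \<otimes> y \<in> U"
  shows "x \<in> U"
proof -
  obtain k where "k \<in> carrier R" "x \<otimes> y \<in> macias_sigma R k" "macias_sigma R k - {\<zero>} \<subseteq> U"
    using assms(1,4) unfolding openin_Macias arbitrary_union_of_alt by blast
  then show ?thesis
    using macias_sigma_divisor_closed[of k x y] assms(2,3) by blast
qed

text \<open>
  The passage from divisors to ultraconnectedness, common to both spaces. If \<open>x\<close> is in the closed
  set \<open>C\<close>, then so is \<open>z\<close>: otherwise the complement of \<open>C\<close> would be an open set containing \<open>z\<close>
  but not \<open>x\<close>.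
\<close>

lemma ultraconnected_spaceI:
  assumes "\<And>x y. x \<in> topspace X \<Longrightarrow> y \<in> topspace X \<Longrightarrow>
    \<exists>z \<in> topspace X. \<forall>U. openin X U \<and> z \<in> U \<longrightarrow> x \<in> U \<and> y \<in> U"
  shows "ultraconnected_space X"
  unfolding ultraconnected_space_def
proof (intro allI impI, elim conjE)
  fix C D assume CD: "closedin X C" "closedin X D" "C \<noteq> {}" "D \<noteq> {}"
  then obtain x y where xy: "x \<in> C" "y \<in> D"
    by blast
  then have "x \<in> topspace X" "y \<in> topspace X"
    using CD closedin_subset by blast+
  from assms[OF this] obtain z where z: "z \<in> topspace X"
    "\<And>U. openin X U \<Longrightarrow> z \<in> U \<Longrightarrow> x \<in> U \<and> y \<in> U" by blast
  have "openin X (topspace X - C)" "openin X (topspace X - D)"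
    using CD by auto
  then have "z \<in> C" "z \<in> D"
    using z xy by blast+
  then show "C \<inter> D \<noteq> {}"
    by blast
qed

lemma (in cring) ultraconnected_Macias_tilde: "ultraconnected_space (Macias_tilde R)"
proof (rule ultraconnected_spaceI, unfold topspace_Macias_tilde)
  fix x y assume xy: "x \<in> carrier R" "y \<in> carrier R"
  then have "x \<in> U \<and> y \<in> U" if "openin (Macias_tilde R) U" "x \<otimes> y \<in> U" for U
    using that xy openin_Macias_tilde_divisor_closed[of U x y]
      openin_Macias_tilde_divisor_closed[of U y x] m_comm[of x y] by simp
  moreover have "x \<otimes> y \<in> carrier R"
    using xy by simp
  ultimately show
    "\<exists>z\<in>carrier R. \<forall>U. openin (Macias_tilde R) U \<and> z \<in> U \<longrightarrow> x \<in> U \<and> y \<in> U"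
    by blast
qed

lemma (in domain) ultraconnected_Macias: "ultraconnected_space (Macias R)"
proof (rule ultraconnected_spaceI, unfold topspace_Macias)
  fix x y assume xy: "x \<in> carrier R - {\<zero>}" "y \<in> carrier R - {\<zero>}"
  then have "x \<in> U \<and> y \<in> U" if "openin (Macias R) U" "x \<otimes> y \<in> U" for U
    using that xy openin_Macias_divisor_closed[of U x y]
      openin_Macias_divisor_closed[of U y x] m_comm[of x y] by simp
  moreover have "x \<otimes> y \<in> carrier R - {\<zero>}"
    using xy integral by auto
  ultimately show
    "\<exists>z\<in>carrier R - {\<zero>}. \<forall>U. openin (Macias R) U \<and> z \<in> U \<longrightarrow> x \<in> U \<and> y \<in> U"
    by blast
qed

theorem corollary3p7:
  fixes R :: "('a, 'm) ring_scheme"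
  assumes "domain R" and "\<not> field R"
  shows "ultraconnected_space (Macias_tilde R) \<and> ultraconnected_space (Macias R) \<and>
    normal_space (Macias_tilde R) \<and> normal_space (Macias R) \<and>
    limit_point_compact_space (Macias_tilde R) \<and> limit_point_compact_space (Macias R) \<and>
    pseudocompact_space (Macias_tilde R) \<and> pseudocompact_space (Macias R) \<and>
    path_connected_space (Macias_tilde R) \<and> path_connected_space (Macias R)"
proof -
  interpret domain R
    by (rule assms(1))
  show ?thesis
    using ultraconnected_Macias_tilde ultraconnected_Macias
    by (simp add: ultraconnected_imp_normal_space ultraconnected_imp_limit_point_compact_space
        ultraconnected_imp_pseudocompact_space ultraconnected_imp_path_connected_space)
qed

end
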